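(* Let $[t_0,t_1]\subset\mathbb R$ be a compact interval, $r\in\mathbb N$, fix $\Lambda>0$ with $[t_0,t_1]\subset[-\Lambda,\Lambda]$, and for $L>\Lambda$, $K\in\mathbb N$ let $$\widetilde C_{\theta,L,K}(s,t)=\sum_{k=1}^K S_\theta\left(\frac{k\pi}{2L}\right)\phi_{k,L}(s)\phi_{k,L}(t),\qquad \phi_{k,L}(t)=L^{-1/2}\sin\left(\frac{k\pi(t+L)}{2L}\right),$$ where $C_\theta$ is the restriction to $[t_0,t_1]^2$ of a real stationary covariance function on $\mathbb R$ with spectral density $S_\theta$. Assume that for every pair $(a,b)\in\{0,\ldots,r\}^2$ the function $\omega\mapsto\omega^{a+b}S_\theta(\omega)$ is uniformly bounded on $(0,\infty)$, is differentiable with bounded derivative on $(0,\infty)$, and that both it and its derivative are integrable on $(0,\infty)$. For $p,q\in\{-r,\ldots,r\}$ set $$C_\theta^{[p,q]}:=\mathcal A_{1,t_0}^{[p]}\mathcal A_{2,t_0}^{[q]}C_\theta,\qquad \widetilde C_{\theta,L,K}^{[p,q]}:=\mathcal A_{1,t_0}^{[p]}\mathcal A_{2,t_0}^{[q]}\widetilde C_{\theta,L,K}.$$ Then there is a finite constant $M_r$, depending only on $r$ and $t_1-t_0$, such that $$\max_{p,q\in\{-r,\ldots,r\}}\left\|\widetilde C_{\theta,L,K}^{[p,q]}-C_\theta^{[p,q]}\right\|_\infty\le M_r\max_{0\le a,b\le r}\left\|D_1^aD_2^b\widetilde C_{\theta,L,K}-D_1^aD_2^bC_\theta\right\|_\infty,$$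 where $\|\cdot\|_\infty$ is the supremum norm on $[t_0,t_1]^2$. Consequently, as $K,L\to\infty$ with $K/L\to\infty$, $$\max_{p,q\in\{-r,\ldots,r\}}\sup_{(s,t)\in[t_0,t_1]^2}\left|\widetilde C_{\theta,L,K}^{[p,q]}(s,t)-C_\theta^{[p,q]}(s,t)\right|\to0.$$
   Context: $D_1,D_2$ differentiate in the first and second argument. For $q>0$, $(\mathcal I_{t_0}^q f)(t)=\frac{1}{(q-1)!}\int_{t_0}^t(t-u)^{q-1}f(u)\,du$. The signed-order operator is $\mathcal A_{t_0}^{[k]}=D_t^{-k}$ for $k<0$, $\mathrm{Id}$ for $k=0$, $\mathcal I_{t_0}^k$ for $k>0$; $\mathcal A_{1,t_0}^{[k]}$ and $\mathcal A_{2,t_0}^{[k]}$ apply it in the first and second argument of a bivariate function. A stationary covariance function is written $C_\theta(s,t)=C_\theta(\tau)$, $\tau=s-t$. Its spectral density is $S_\theta(\omega)=\int_{-\infty}^\infty C_\theta(\tau)e^{-\mathrm i\omega\tau}\,d\tau$, an even nonnegative function, so that (Fourier inversion) $C_\theta(\tau)=\frac1{2\pi}\int_{\mathbb R}S_\theta(\omega)e^{\mathrm i\omega\tau}\,d\omega$ for all $\tau\in\mathbb R$. *)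

theory Defs
  imports "HOL-Analysis.Analysis"
begin

(* Functions on [t0,t1] are represented by total functions on the reals. Derivatives are taken
   within [t0,t1] (one-sided at the endpoints), so only values on the interval matter. *)
definition D_on :: "real \<Rightarrow> real \<Rightarrow> (real \<Rightarrow> real) \<Rightarrow> real \<Rightarrow> real" where
  "D_on t0 t1 f t = vector_derivative f (at t within {t0..t1})"

definition iter_integral :: "real \<Rightarrow> nat \<Rightarrow> (real \<Rightarrow> real) \<Rightarrow> real \<Rightarrow> real" where
  "iter_integral t0 q f t = 1 / fact (q - 1) * integral {t0..t} (\<lambda>u. (t - u) ^ (q - 1) * f u)"

definition signed_op :: "real \<Rightarrow> real \<Rightarrow> int \<Rightarrow> (real \<Rightarrow> real) \<Rightarrow> real \<Rightarrow> real" where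
  "signed_op t0 t1 k f =
     (if k < 0 then (D_on t0 t1 ^^ nat (- k)) f
      else if k = 0 then f
      else iter_integral t0 (nat k) f)"

definition in_fst ::
  "((real \<Rightarrow> real) \<Rightarrow> real \<Rightarrow> real) \<Rightarrow> (real \<Rightarrow> real \<Rightarrow> real) \<Rightarrow> real \<Rightarrow> real \<Rightarrow> real" where
  "in_fst T F s t = T (\<lambda>u. F u t) s"

definition in_snd ::
  "((real \<Rightarrow> real) \<Rightarrow> real \<Rightarrow> real) \<Rightarrow> (real \<Rightarrow> real \<Rightarrow> real) \<Rightarrow> real \<Rightarrow> real \<Rightarrow> real" where
  "in_snd T F s t = T (\<lambda>v. F s v) t"

definition mixed_deriv ::
  "real \<Rightarrow> real \<Rightarrow> nat \<Rightarrow> nat \<Rightarrow> (real \<Rightarrow> real \<Rightarrow> real) \<Rightarrow> real \<Rightarrow> real \<Rightarrow> real" where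
  "mixed_deriv t0 t1 a b F =
     (in_fst (D_on t0 t1) ^^ a) ((in_snd (D_on t0 t1) ^^ b) F)"

definition signed_op2 ::
  "real \<Rightarrow> real \<Rightarrow> int \<Rightarrow> int \<Rightarrow> (real \<Rightarrow> real \<Rightarrow> real) \<Rightarrow> real \<Rightarrow> real \<Rightarrow> real" where
  "signed_op2 t0 t1 p q F = in_fst (signed_op t0 t1 p) (in_snd (signed_op t0 t1 q) F)"

(* Values in ennreal: unbounded functions get norm infinity. *)
definition sup_dist ::
  "real \<Rightarrow> real \<Rightarrow> (real \<Rightarrow> real \<Rightarrow> real) \<Rightarrow> (real \<Rightarrow> real \<Rightarrow> real) \<Rightarrow> ennreal" where
  "sup_dist t0 t1 F G = (SUP (s, t) \<in> {t0..t1} \<times> {t0..t1}. ennreal \<bar>F s t - G s t\<bar>)"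

definition covariance_function :: "(real \<Rightarrow> real \<Rightarrow> real) \<Rightarrow> bool" where
  "covariance_function k \<longleftrightarrow>
     (\<forall>s t. k s t = k t s) \<and>
     (\<forall>X c. finite X \<longrightarrow> (\<Sum>x\<in>X. \<Sum>y\<in>X. c x * c y * k x y) \<ge> 0)"

definition stationary_kernel :: "(real \<Rightarrow> real) \<Rightarrow> real \<Rightarrow> real \<Rightarrow> real" where
  "stationary_kernel C s t = C (s - t)"

(* The two integrability conjuncts make the Bochner integrals meaningful. They exclude nothing:
   a non-integrable integrand has integral 0, so the two integral identities alone would force
   C = 0 and S = 0. *)
definition has_spectral_density :: "(real \<Rightarrow> real) \<Rightarrow> (real \<Rightarrow> real) \<Rightarrow> bool" where
  "has_spectral_density C S \<longleftrightarrow>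
     integrable lborel C \<and>
     (\<forall>\<omega>. complex_of_real (S \<omega>) =
        (LINT \<tau>|lborel. complex_of_real (C \<tau>) * exp (- (\<i> * complex_of_real (\<omega> * \<tau>))))) \<and>
     (\<forall>\<omega>. S (- \<omega>) = S \<omega>) \<and> (\<forall>\<omega>. S \<omega> \<ge> 0) \<and>
     integrable lborel S \<and>
     (\<forall>\<tau>. complex_of_real (C \<tau>) =
        1 / (2 * complex_of_real pi) *
        (LINT \<omega>|lborel. complex_of_real (S \<omega>) * exp (\<i> * complex_of_real (\<omega> * \<tau>))))"

definition spectral_regularity :: "nat \<Rightarrow> (real \<Rightarrow> real) \<Rightarrow> bool" where
  "spectral_regularity r S \<longleftrightarrow>
     (\<forall>a\<in>{0..r}. \<forall>b\<in>{0..r}. let f = (\<lambda>\<omega>. \<omega> ^ (a + b) * S \<omega>) in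
        bounded (f ` {0<..}) \<and>
        (\<forall>\<omega>>0. f differentiable (at \<omega>)) \<and>
        bounded (deriv f ` {0<..}) \<and>
        set_integrable lborel {0<..} f \<and>
        set_integrable lborel {0<..} (deriv f))"

definition basis_fun :: "nat \<Rightarrow> real \<Rightarrow> real \<Rightarrow> real" where
  "basis_fun k L t = L powr (- 1 / 2) * sin (real k * pi * (t + L) / (2 * L))"

definition approx_kernel :: "(real \<Rightarrow> real) \<Rightarrow> real \<Rightarrow> nat \<Rightarrow> real \<Rightarrow> real \<Rightarrow> real" where
  "approx_kernel S L K s t =
     (\<Sum>k = 1..K. S (real k * pi / (2 * L)) * basis_fun k L s * basis_fun k L t)"

(* K, L \<rightarrow> \<infinity> jointly, restricted to the regime K / L \<rightarrow> \<infinity>. *)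
definition joint_limit :: "(real \<times> nat) filter" where
  "joint_limit = inf (at_top \<times>\<^sub>F at_top) (filtercomap (\<lambda>(L, K). real K / L) at_top)"

end

theory Submission
  imports Defs
begin

text \<open>
  Since both kernels are smooth of order r in each variable, derivatives in one variable commute
  with integration in the other, so every signed operator on the square amounts to iterated
  integrals applied to a single mixed derivative; each integral costs at most a power of
  1 + (t1 - t0). For the convergence, write h = pi / (2 L). The product-to-sum formula turns the
  mixed derivatives of the approximation into a Riemann sum of step h for the cosine integral
  representing those of C, minus a sum with alternating signs. Both the Riemann sum error and the
  alternating sum are of order h because the weighted spectral density has an integrable
  derivative; cutting the sum at K leaves the tail of an absolutely convergent integral
  beyond K h.
\<close>

section \<open>Signed operators on differentiable families\<close>

text \<open>\<open>G a b\<close> plays the role of D_1^a D_2^b of \<open>G 0 0\<close>. Listing all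
  mixed derivatives as explicit functions replaces nested \<open>vector_derivative\<close> terms by
  formulas. Derivatives are taken within the interval to match \<open>D_on\<close>, and joint
  continuity is what differentiation under the integral sign requires.\<close>

definition deriv_family ::
  "real \<Rightarrow> real \<Rightarrow> nat \<Rightarrow> (nat \<Rightarrow> nat \<Rightarrow> real \<Rightarrow> real \<Rightarrow> real) \<Rightarrow> bool" where
  "deriv_family t0 t1 r G \<longleftrightarrow>
     (\<forall>a\<le>r. \<forall>b\<le>r. continuous_on ({t0..t1} \<times> {t0..t1}) (\<lambda>(s, t). G a b s t)) \<and>
     (\<forall>a<r. \<forall>b\<le>r. \<forall>s\<in>{t0..t1}. \<forall>t\<in>{t0..t1}.
        ((\<lambda>u. G a b u t) has_real_derivative G (Suc a) b s t) (at s within {t0..t1})) \<and>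
     (\<forall>a\<le>r. \<forall>b<r. \<forall>s\<in>{t0..t1}. \<forall>t\<in>{t0..t1}.
        ((\<lambda>v. G a b s v) has_real_derivative G a (Suc b) s t) (at t within {t0..t1}))"

text \<open>Induction on \<open>n\<close>. The iterates agree with the family \<open>F\<close> only
  on the interval, and this suffices because a derivative within the interval sees no other
  values.\<close>

lemma funpow_D_on_eq:
  assumes "t0 < t1"
    and "\<And>i x. \<lbrakk>i < n; x \<in> {t0..t1}\<rbrakk> \<Longrightarrow>
      (F i has_real_derivative F (Suc i) x) (at x within {t0..t1})"
    and "\<And>x. x \<in> {t0..t1} \<Longrightarrow> f x = F 0 x"
    and "x \<in> {t0..t1}"
  shows "(D_on t0 t1 ^^ n) f x = F n x"
  using assms(2,4)
proof (induction n arbitrary: x)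
  case 0
  then show ?case using assms(3) by simp
next
  case (Suc n)
  have "((D_on t0 t1 ^^ n) f has_real_derivative F (Suc n) x) (at x within {t0..t1})"
  proof (rule has_field_derivative_transform_within[OF _ zero_less_one])
    show "(F n has_real_derivative F (Suc n) x) (at x within {t0..t1})"
      using Suc.prems by blast
    show "x \<in> {t0..t1}" by fact
    show "F n y = (D_on t0 t1 ^^ n) f y" if "y \<in> {t0..t1}" for y
      using Suc.IH[of y] Suc.prems that by simp
  qed
  \<comment> \<open>As \<open>t0 < t1\<close>, the derivative within the interval is unique even at
    an endpoint, so \<open>vector_derivative\<close> must pick this value.\<close>
  then have "vector_derivative ((D_on t0 t1 ^^ n) f) (at x within {t0..t1}) = F (Suc n) x"
    using vector_derivative_within_cbox[of t0 t1 x "(D_on t0 t1 ^^ n) f"] assms(1) Suc.prems(2)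
    by (simp add: has_real_derivative_iff_has_vector_derivative)
  then show ?case by (simp add: D_on_def[of t0 t1 "(D_on t0 t1 ^^ n) f"])
qed

lemma in_fst_funpow: "(in_fst T ^^ n) F = in_fst (T ^^ n) F"
  by (induction n) (auto simp: in_fst_def fun_eq_iff)

lemma in_snd_funpow: "(in_snd T ^^ n) F = in_snd (T ^^ n) F"
  by (induction n) (simp_all add: in_snd_def)

lemma mixed_deriv_eq:
  assumes "t0 < t1" "deriv_family t0 t1 r G" "a \<le> r" "b \<le> r" "s \<in> {t0..t1}" "t \<in> {t0..t1}"
  shows "mixed_deriv t0 t1 a b (G 0 0) s t = G a b s t"
proof -
  have "(D_on t0 t1 ^^ b) (G 0 0 u) t = G 0 b u t" if "u \<in> {t0..t1}" for u
    using assms that funpow_D_on_eq[of t0 t1 b "\<lambda>i. G 0 i u" "G 0 0 u" t]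
    unfolding deriv_family_def by auto
  then have "(D_on t0 t1 ^^ a) (\<lambda>u. (D_on t0 t1 ^^ b) (G 0 0 u) t) s = G a b s t"
    using assms funpow_D_on_eq[of t0 t1 a "\<lambda>i u. G i b u t"
        "\<lambda>u. (D_on t0 t1 ^^ b) (G 0 0 u) t" s]
    unfolding deriv_family_def by auto
  then show ?thesis
    by (simp add: mixed_deriv_def in_fst_funpow in_snd_funpow in_fst_def in_snd_def)
qed

section \<open>Iterated integrals: stability, continuity and differentiation in a parameter\<close>

lemma signed_op_nonneg:
  "signed_op t0 t1 (int q) f = (if q = 0 then f else iter_integral t0 q f)"
  by (simp add: signed_op_def)

lemma signed_op_int_cong:
  assumes "\<And>x. x \<in> {t0..t1} \<Longrightarrow> f x = g x" "t \<in> {t0..t1}"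
  shows "signed_op t0 t1 (int q) f t = signed_op t0 t1 (int q) g t"
proof -
  have "integral {t0..t} (\<lambda>u. (t - u) ^ (q - 1) * f u)
      = integral {t0..t} (\<lambda>u. (t - u) ^ (q - 1) * g u)"
    using assms by (intro integral_cong) auto
  then show ?thesis using assms by (simp add: signed_op_nonneg iter_integral_def)
qed

text \<open>With T = t1 - t0, the weight is at most T^(q-1), the interval has length at most T and
  1/(q-1)! is at most 1, so an integral of order q costs a factor T^q. The base is enlarged to 1 + T
  so that the factor increases with q and different orders can later share one exponent.\<close>

lemma signed_op_int_diff_bound:
  assumes "continuous_on {t0..t1} f" "continuous_on {t0..t1} g"
    and bd: "\<And>x. x \<in> {t0..t1} \<Longrightarrow> \<bar>f x - g x\<bar> \<le> d" and t: "t \<in> {t0..t1}"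
  shows "\<bar>signed_op t0 t1 (int q) f t - signed_op t0 t1 (int q) g t\<bar> \<le> (1 + (t1 - t0)) ^ q * d"
proof (cases "q = 0")
  case True
  then show ?thesis using bd[OF t] by (simp add: signed_op_def)
next
  case False
  let ?w = "\<lambda>u. (t - u) ^ (q - 1)"
  have d: "0 \<le> d" using bd[OF t] by linarith
  have sub: "{t0..t} \<subseteq> {t0..t1}" using t by auto
  have cf: "continuous_on {t0..t} f" and cg: "continuous_on {t0..t} g"
    using assms(1,2) sub continuous_on_subset by blast+
  have "integral {t0..t} (\<lambda>u. ?w u * f u) - integral {t0..t} (\<lambda>u. ?w u * g u)
      = integral {t0..t} (\<lambda>u. ?w u * f u - ?w u * g u)"
    by (intro integral_diff[symmetric] integrable_continuous_interval continuous_intros cf cg)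
  moreover have "norm (integral {t0..t} (\<lambda>u. ?w u * f u - ?w u * g u))
      \<le> ((t1 - t0) ^ (q - 1) * d) * (t - t0)"
  proof (rule integral_bound)
    show "t0 \<le> t" using t by simp
    show "continuous_on {t0..t} (\<lambda>u. ?w u * f u - ?w u * g u)"
      by (intro continuous_intros cf cg)
    show "norm (?w u * f u - ?w u * g u) \<le> (t1 - t0) ^ (q - 1) * d" if "u \<in> {t0..t}" for u
    proof -
      have "norm (?w u * f u - ?w u * g u) = ?w u * \<bar>f u - g u\<bar>"
        using that by (simp add: abs_mult flip: right_diff_distrib)
      also have "\<dots> \<le> (t1 - t0) ^ (q - 1) * d"
        using that t by (intro mult_mono power_mono bd) auto
      finally show ?thesis .
    qed
  qed
  ultimately have *: "\<bar>integral {t0..t} (\<lambda>u. ?w u * f u) - integral {t0..t} (\<lambda>u. ?w u * g u)\<bar>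
      \<le> ((t1 - t0) ^ (q - 1) * d) * (t - t0)" by simp
  have fact1: "1 / fact (q - 1) \<le> (1::real)" by simp
  have "\<bar>signed_op t0 t1 (int q) f t - signed_op t0 t1 (int q) g t\<bar> = 1 / fact (q - 1) *
      \<bar>integral {t0..t} (\<lambda>u. ?w u * f u) - integral {t0..t} (\<lambda>u. ?w u * g u)\<bar>"
    using False
    by (simp add: signed_op_nonneg iter_integral_def abs_mult flip: diff_divide_distrib)
  also have "\<dots> \<le> 1 * (((t1 - t0) ^ (q - 1) * d) * (t - t0))"
    by (intro mult_mono fact1 *) auto
  also have "\<dots> \<le> 1 * (((t1 - t0) ^ (q - 1) * d) * (t1 - t0))"
    using t d by (intro mult_left_mono) auto
  also have "\<dots> = (t1 - t0) ^ q * d"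
    using False by (cases q) auto
  also have "\<dots> \<le> (1 + (t1 - t0)) ^ q * d"
    using t d by (intro mult_right_mono power_mono) auto
  finally show ?thesis .
qed

lemma continuous_on_weighted_slice:
  fixes H :: "real \<Rightarrow> real \<Rightarrow> real"
  assumes "continuous_on ({t0..t1} \<times> {t0..t1}) (\<lambda>(s, t). H s t)" "t \<in> {t0..t1}"
  shows "continuous_on ({t0..t1} \<times> {t0..t}) (\<lambda>(u, v). (t - v) ^ n * H u v)"
proof -
  have "continuous_on ({t0..t1} \<times> {t0..t}) (\<lambda>(s, t). H s t)"
    using assms by (elim continuous_on_subset) auto
  then show ?thesis
    by (auto simp: case_prod_beta intro!: continuous_intros)
qed

text \<open>The outer operator integrates over the first variable, so its error bound needs the
  inner result to be continuous there. Joint continuity on a compact square passes to the parameter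
  integral.\<close>

lemma continuous_on_signed_op_int:
  assumes "continuous_on ({t0..t1} \<times> {t0..t1}) (\<lambda>(s, t). H s t)" "t \<in> {t0..t1}"
  shows "continuous_on {t0..t1} (\<lambda>u. signed_op t0 t1 (int q) (H u) t)"
proof (cases "q = 0")
  case True
  have "continuous_on {t0..t1} (\<lambda>u. (\<lambda>(s, t). H s t) (u, t))"
    by (rule continuous_on_compose2[OF assms(1)]) (use assms(2) in \<open>auto intro!: continuous_intros\<close>)
  then show ?thesis using True by (simp add: signed_op_def)
next
  case False
  have "continuous_on {t0..t1} (\<lambda>u. integral (cbox t0 t) (\<lambda>v. (t - v) ^ (q - 1) * H u v))"
    using continuous_on_weighted_slice[OF assms, of "q - 1"]
    by (intro integral_continuous_on_param) simp
  then show ?thesis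
    using False by (auto simp: signed_op_nonneg iter_integral_def intro!: continuous_intros)
qed

lemma continuous_on_slice:
  fixes H :: "real \<Rightarrow> real \<Rightarrow> real"
  assumes "continuous_on (A \<times> B) (\<lambda>(s, t). H s t)" "s \<in> A"
  shows "continuous_on B (H s)"
proof -
  have "continuous_on B (\<lambda>v. (\<lambda>(s, t). H s t) (s, v))"
    by (rule continuous_on_compose2[OF assms(1)]) (use assms(2) in \<open>auto intro!: continuous_intros\<close>)
  then show ?thesis by simp
qed

text \<open>Leibniz rule: neither the weight nor the limits of integration depend on the first
  variable. This makes D_1 commute with integration in the second variable.\<close>

lemma has_real_derivative_signed_op_int:
  fixes H H' :: "real \<Rightarrow> real \<Rightarrow> real"
  assumes "continuous_on ({t0..t1} \<times> {t0..t1}) (\<lambda>(s, t). H s t)"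
    and cont': "continuous_on ({t0..t1} \<times> {t0..t1}) (\<lambda>(s, t). H' s t)"
    and der: "\<And>s t. \<lbrakk>s \<in> {t0..t1}; t \<in> {t0..t1}\<rbrakk> \<Longrightarrow>
      ((\<lambda>u. H u t) has_real_derivative H' s t) (at s within {t0..t1})"
    and s: "s \<in> {t0..t1}" and t: "t \<in> {t0..t1}"
  shows "((\<lambda>u. signed_op t0 t1 (int q) (H u) t) has_real_derivative
    signed_op t0 t1 (int q) (H' s) t) (at s within {t0..t1})"
proof (cases "q = 0")
  case True
  then show ?thesis using der[OF s t] by (simp add: signed_op_def)
next
  case False
  have "((\<lambda>u. integral (cbox t0 t) (\<lambda>v. (t - v) ^ (q - 1) * H u v)) has_real_derivative
      integral (cbox t0 t) (\<lambda>v. (t - v) ^ (q - 1) * H' s v)) (at s within {t0..t1})"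
  proof (rule leibniz_rule_field_derivative)
    show "((\<lambda>u. (t - v) ^ (q - 1) * H u v) has_real_derivative (t - v) ^ (q - 1) * H' u v)
        (at u within {t0..t1})" if "u \<in> {t0..t1}" "v \<in> cbox t0 t" for u v
      using that t by (intro DERIV_cmult der) auto
    show "(\<lambda>v. (t - v) ^ (q - 1) * H u v) integrable_on cbox t0 t" if "u \<in> {t0..t1}" for u
    proof -
      have "continuous_on {t0..t} (H u)"
        using continuous_on_slice[OF assms(1) that] t by (elim continuous_on_subset) auto
      then show ?thesis
        by (auto intro!: integrable_continuous_interval continuous_intros)
    qed
    show "continuous_on ({t0..t1} \<times> cbox t0 t) (\<lambda>(u, v). (t - v) ^ (q - 1) * H' u v)"
      using continuous_on_weighted_slice[OF cont' t] by simp
  qed (use s in auto)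
  then show ?thesis
    using False by (auto simp: signed_op_nonneg iter_integral_def intro!: DERIV_cdivide)
qed

text \<open>\<open>nat p\<close> and \<open>nat (- p)\<close> are the positive and negative parts of
  \<open>p\<close>, at most one of them nonzero, and likewise for \<open>q\<close>. All derivatives
  can therefore be collected innermost; the one case where operators must change places is
  \<open>p < 0 < q\<close>, settled by the Leibniz rule.\<close>

lemma signed_op2_eq:
  assumes "t0 < t1" and G: "deriv_family t0 t1 r G"
    and p: "p \<in> {- int r..int r}" and q: "q \<in> {- int r..int r}"
    and s: "s \<in> {t0..t1}" and t: "t \<in> {t0..t1}"
  shows "signed_op2 t0 t1 p q (G 0 0) s t =
    signed_op t0 t1 (int (nat p))
      (\<lambda>u. signed_op t0 t1 (int (nat q)) (G (nat (- p)) (nat (- q)) u) t) s"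
proof -
  have inner: "signed_op t0 t1 q (G 0 0 u) t = signed_op t0 t1 (int (nat q)) (G 0 (nat (- q)) u) t"
    if u: "u \<in> {t0..t1}" for u
  proof (cases "q < 0")
    case True
    have "(D_on t0 t1 ^^ nat (- q)) (G 0 0 u) t = G 0 (nat (- q)) u t"
      using assms u funpow_D_on_eq[of t0 t1 "nat (- q)" "\<lambda>i. G 0 i u" "G 0 0 u" t]
      unfolding deriv_family_def by auto
    then show ?thesis using True by (simp add: signed_op_def)
  qed simp
  let ?H = "\<lambda>i u. signed_op t0 t1 (int (nat q)) (G i (nat (- q)) u) t"
  have "signed_op t0 t1 p (\<lambda>u. signed_op t0 t1 q (G 0 0 u) t) s
      = signed_op t0 t1 (int (nat p)) (?H (nat (- p))) s"
  proof (cases "p < 0")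
    case True
    \<comment> \<open>The functions \<open>?H i\<close> form a chain in which each is the derivative
      of the one before, so iterating \<open>D_on\<close> walks along it.\<close>
    have "(D_on t0 t1 ^^ nat (- p)) (\<lambda>u. signed_op t0 t1 q (G 0 0 u) t) s = ?H (nat (- p)) s"
    proof (rule funpow_D_on_eq)
      fix i x assume "i < nat (- p)" and x: "x \<in> {t0..t1}"
      then have "i < r" using p by auto
      then show "(?H i has_real_derivative ?H (Suc i) x) (at x within {t0..t1})"
        using G q x t unfolding deriv_family_def
        by (intro has_real_derivative_signed_op_int) auto
    qed (use assms inner in auto)
    then show ?thesis using True by (simp add: signed_op_def)
  next
    case False
    then show ?thesis
      using signed_op_int_cong[of t0 t1 "\<lambda>u. signed_op t0 t1 q (G 0 0 u) t" "?H 0" s "nat p"]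
        inner s by simp
  qed
  then show ?thesis by (simp add: signed_op2_def in_fst_def in_snd_def)
qed

text \<open>The integral bound is applied twice, first in the second variable for every fixed
  \<open>u\<close>, then in the first variable to the resulting functions of
  \<open>u\<close>.\<close>

lemma signed_op2_diff_bound:
  assumes "t0 < t1" and G: "deriv_family t0 t1 r G" and G': "deriv_family t0 t1 r G'"
    and bd: "\<And>a b s t. \<lbrakk>a \<le> r; b \<le> r; s \<in> {t0..t1}; t \<in> {t0..t1}\<rbrakk> \<Longrightarrow>
      \<bar>G a b s t - G' a b s t\<bar> \<le> d"
    and p: "p \<in> {- int r..int r}" and q: "q \<in> {- int r..int r}"
    and s: "s \<in> {t0..t1}" and t: "t \<in> {t0..t1}"
  shows "\<bar>signed_op2 t0 t1 p q (G 0 0) s t - signed_op2 t0 t1 p q (G' 0 0) s t\<bar>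
    \<le> (1 + (t1 - t0)) ^ (2 * r) * d"
proof -
  let ?a = "nat (- p)" and ?b = "nat (- q)" and ?c = "1 + (t1 - t0)"
  have ab: "?a \<le> r" "?b \<le> r" using p q by auto
  have d: "0 \<le> d" using bd[of 0 0 s t] s t by force
  have cont: "continuous_on ({t0..t1} \<times> {t0..t1}) (\<lambda>(s, t). G ?a ?b s t)"
    "continuous_on ({t0..t1} \<times> {t0..t1}) (\<lambda>(s, t). G' ?a ?b s t)"
    using G G' ab unfolding deriv_family_def by auto
  have inner: "\<bar>signed_op t0 t1 (int (nat q)) (G ?a ?b u) t
      - signed_op t0 t1 (int (nat q)) (G' ?a ?b u) t\<bar> \<le> ?c ^ nat q * d" if "u \<in> {t0..t1}" for u
    using cont that ab t by (intro signed_op_int_diff_bound bd) (auto intro: continuous_on_slice)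
  have "\<bar>signed_op2 t0 t1 p q (G 0 0) s t - signed_op2 t0 t1 p q (G' 0 0) s t\<bar>
      \<le> ?c ^ nat p * (?c ^ nat q * d)"
    unfolding signed_op2_eq[OF assms(1) G p q s t] signed_op2_eq[OF assms(1) G' p q s t]
    by (intro signed_op_int_diff_bound continuous_on_signed_op_int cont inner s t)
  also have "\<dots> = ?c ^ (nat p + nat q) * d" by (simp add: power_add)
  \<comment> \<open>\<open>nat p\<close> and \<open>nat q\<close> are at most \<open>r\<close>, and
    the base is at least 1.\<close>
  also have "\<dots> \<le> ?c ^ (2 * r) * d"
    using assms(1) p q d by (intro mult_right_mono power_increasing) auto
  finally show ?thesis .
qed

section \<open>From pointwise bounds to suprema and finite maxima\<close>

lemma sup_dist_le_iff:
  "sup_dist t0 t1 F G \<le> x \<longleftrightarrow>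
    (\<forall>s\<in>{t0..t1}. \<forall>t\<in>{t0..t1}. ennreal \<bar>F s t - G s t\<bar> \<le> x)"
  unfolding sup_dist_def by (auto simp: SUP_le_iff)

lemma Max_sup_dist_le_iff:
  assumes "finite A" "A \<noteq> {}"
  shows "(MAX (p, q) \<in> A. sup_dist t0 t1 (F p q) (G p q)) \<le> x \<longleftrightarrow>
    (\<forall>(p, q)\<in>A. \<forall>s\<in>{t0..t1}. \<forall>t\<in>{t0..t1}. ennreal \<bar>F p q s t - G p q s t\<bar> \<le> x)"
  using assms by (auto simp: sup_dist_le_iff)

lemma Max_sup_dist_le:
  assumes "finite A" "A \<noteq> {}"
    and "\<And>p q s t. \<lbrakk>(p, q) \<in> A; s \<in> {t0..t1}; t \<in> {t0..t1}\<rbrakk> \<Longrightarrow> \<bar>F p q s t - G p q s t\<bar> \<le> d"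
  shows "(MAX (p, q) \<in> A. sup_dist t0 t1 (F p q) (G p q)) \<le> ennreal d"
  using assms by (subst Max_sup_dist_le_iff) (auto intro!: ennreal_leI)

text \<open>If the maximum on the right is a finite \<open>d\<close>, then \<open>d\<close> bounds
  all pointwise differences of the families, and the pointwise estimate applies.\<close>

lemma signed_op2_Max_le:
  assumes "t0 < t1" and G: "deriv_family t0 t1 r G" and G': "deriv_family t0 t1 r G'"
  shows "(MAX (p, q) \<in> {- int r..int r} \<times> {- int r..int r}.
      sup_dist t0 t1 (signed_op2 t0 t1 p q (G 0 0)) (signed_op2 t0 t1 p q (G' 0 0)))
    \<le> ennreal ((1 + (t1 - t0)) ^ (2 * r)) * (MAX (a, b) \<in> {0..r} \<times> {0..r}.
      sup_dist t0 t1 (mixed_deriv t0 t1 a b (G 0 0)) (mixed_deriv t0 t1 a b (G' 0 0)))"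
    (is "?l \<le> ennreal ?M * ?R")
proof (cases ?R)
  case (real d)
  have "\<bar>G a b s t - G' a b s t\<bar> \<le> d"
    if "a \<le> r" "b \<le> r" "s \<in> {t0..t1}" "t \<in> {t0..t1}" for a b s t
  proof -
    have "?R \<le> ennreal d" using real by simp
    then have "\<forall>(a, b)\<in>{0..r} \<times> {0..r}. \<forall>s\<in>{t0..t1}. \<forall>t\<in>{t0..t1}.
        ennreal \<bar>mixed_deriv t0 t1 a b (G 0 0) s t - mixed_deriv t0 t1 a b (G' 0 0) s t\<bar>
        \<le> ennreal d"
      by (subst (asm) Max_sup_dist_le_iff) auto
    then have "ennreal \<bar>mixed_deriv t0 t1 a b (G 0 0) s t - mixed_deriv t0 t1 a b (G' 0 0) s t\<bar>
        \<le> ennreal d" using that by auto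
    then show ?thesis
      using that mixed_deriv_eq[OF assms(1) G that] mixed_deriv_eq[OF assms(1) G' that] real(1)
      by (simp add: ennreal_le_iff)
  qed
  note signed_op2_diff_bound[OF assms this]
  then have "?l \<le> ennreal (?M * d)"
    by (intro Max_sup_dist_le) auto
  then show ?thesis using real assms(1) by (simp add: ennreal_mult)
next
  case top
  \<comment> \<open>Positivity matters here: in \<open>ennreal\<close> the product of 0 and infinity
    is 0, whereas a positive factor keeps the right-hand side infinite.\<close>
  have "0 < ?M" using assms(1) by simp
  then show ?thesis unfolding top using assms(1) by (simp add: ennreal_mult_top)
qed

section \<open>Quadrature of cosine integrals\<close>

lemma set_integrable_mult_bounded:
  fixes f h :: "'a \<Rightarrow> real"
  assumes f: "set_integrable M A f" and [measurable]: "h \<in> borel_measurable M"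
    and h: "\<And>x. \<bar>h x\<bar> \<le> B"
  shows "set_integrable M A (\<lambda>x. f x * h x)"
proof -
  \<comment> \<open>Measurability of \<open>f\<close> is known only on \<open>A\<close>, so the
    indicator stays attached throughout.\<close>
  have [measurable]: "(\<lambda>x. indicator A x *\<^sub>R f x) \<in> borel_measurable M"
    using f unfolding set_integrable_def by (rule borel_measurable_integrable)
  have "integrable M (\<lambda>x. (indicator A x *\<^sub>R f x) * h x)"
  proof (rule Bochner_Integration.integrable_bound)
    show "integrable M (\<lambda>x. B * (indicator A x *\<^sub>R f x))"
      using f unfolding set_integrable_def by (intro integrable_mult_right)
    show "AE x in M. norm (indicator A x *\<^sub>R f x * h x) \<le> norm (B * (indicator A x *\<^sub>R f x))"
    proof (rule AE_I2)
      fix x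
      have "\<bar>h x\<bar> \<le> \<bar>B\<bar>" using h[of x] by linarith
      then show "norm (indicator A x *\<^sub>R f x * h x) \<le> norm (B * (indicator A x *\<^sub>R f x))"
        by (simp add: abs_mult mult_left_mono mult.commute[of "\<bar>B\<bar>"])
    qed
  qed measurable
  then show ?thesis unfolding set_integrable_def by (simp add: mult.assoc)
qed

lemma set_integral_abs_mono_set:
  fixes f :: "real \<Rightarrow> real"
  assumes "set_integrable M B f" "A \<subseteq> B" "A \<in> sets M"
  shows "(LINT x:A|M. \<bar>f x\<bar>) \<le> (LINT x:B|M. \<bar>f x\<bar>)"
  unfolding set_lebesgue_integral_def
proof (rule integral_mono)
  show "integrable M (\<lambda>x. indicator B x *\<^sub>R \<bar>f x\<bar>)"
    using set_integrable_abs[OF assms(1)] by (simp add: set_integrable_def)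
  show "integrable M (\<lambda>x. indicator A x *\<^sub>R \<bar>f x\<bar>)"
    using set_integrable_abs[OF set_integrable_subset[OF assms(1,3,2)]]
    by (simp add: set_integrable_def)
  show "indicator A x *\<^sub>R \<bar>f x\<bar> \<le> indicator B x *\<^sub>R \<bar>f x\<bar>" for x
    using assms(2) by (auto simp: indicator_def)
qed

lemma set_integral_abs_nonneg: "0 \<le> (LINT x:A|M. \<bar>f x :: real\<bar>)"
  unfolding set_lebesgue_integral_def by (intro integral_nonneg_AE) auto

lemma abs_set_integral_le:
  fixes f :: "'a \<Rightarrow> real"
  shows "\<bar>LINT x:A|M. f x\<bar> \<le> (LINT x:A|M. \<bar>f x\<bar>)"
  using integral_norm_bound[of M "\<lambda>x. indicator A x *\<^sub>R f x"]
  unfolding set_lebesgue_integral_def by (simp add: abs_mult)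

lemma set_integral_half_line_split:
  fixes f :: "real \<Rightarrow> real"
  assumes "set_integrable lborel {0<..} f" "0 \<le> a" "a \<le> b"
  shows "(LINT x:{0<..b}|lborel. f x) = (LINT x:{0<..a}|lborel. f x) + (LINT x:{a<..b}|lborel. f x)"
proof -
  have "{0<..b} = {0<..a} \<union> {a<..b}" using assms by auto
  moreover have "set_integrable lborel {0<..a} f" "set_integrable lborel {a<..b} f"
    using assms by (auto intro: set_integrable_subset)
  ultimately show ?thesis by (simp add: set_integral_Un)
qed

text \<open>Fundamental theorem of calculus on [x, y]. Strictness in \<open>a < x\<close> allows
  \<open>a = 0\<close>: the interval then still lies where \<open>f\<close> is
  differentiable.\<close>

lemma abs_increment_le_integral_deriv:
  fixes f f' :: "real \<Rightarrow> real"
  assumes der: "\<And>x. x > 0 \<Longrightarrow> (f has_real_derivative f' x) (at x)"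
    and int: "set_integrable lborel {0<..} f'"
    and "0 \<le> a" "a < x" "x \<le> y" "y \<le> b"
  shows "\<bar>f y - f x\<bar> \<le> (LINT u:{a<..b}|lborel. \<bar>f' u\<bar>)"
proof -
  have ab: "set_integrable lborel {a<..b} f'"
    by (rule set_integrable_subset[OF int]) (use assms in auto)
  have xy: "set_integrable lborel {x..y} f'"
    by (rule set_integrable_subset[OF int]) (use assms in auto)
  have "(f' has_integral f y - f x) {x..y}"
  proof (rule fundamental_theorem_of_calculus)
    show "(f has_vector_derivative f' u) (at u within {x..y})" if "u \<in> {x..y}" for u
      using der[of u] that assms
      by (auto simp: has_real_derivative_iff_has_vector_derivative has_vector_derivative_at_within)
  qed fact
  then have "f y - f x = (LINT u:{x..y}|lborel. f' u)"
    using set_borel_integral_eq_integral[OF xy] by (simp add: integral_unique)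
  also have "\<bar>\<dots>\<bar> \<le> (LINT u:{x..y}|lborel. \<bar>f' u\<bar>)"
    by (rule abs_set_integral_le)
  also have "\<dots> \<le> (LINT u:{a<..b}|lborel. \<bar>f' u\<bar>)"
    using assms by (intro set_integral_abs_mono_set[OF ab]) auto
  finally show ?thesis .
qed

text \<open>Right-endpoint rule, cell by cell: on a cell of length \<open>h\<close> the function
  differs from its right-endpoint value by at most the integral of |f'| over that cell. The cell
  errors add up to \<open>h\<close> times the whole integral. Right endpoints keep every node away
  from 0.\<close>

lemma riemann_sum_error:
  fixes f f' :: "real \<Rightarrow> real"
  assumes der: "\<And>x. x > 0 \<Longrightarrow> (f has_real_derivative f' x) (at x)"
    and f: "set_integrable lborel {0<..} f" and f': "set_integrable lborel {0<..} f'"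
    and h: "h > 0"
  shows "\<bar>(\<Sum>k = 1..K. h * f (real k * h)) - (LINT x:{0<..real K * h}|lborel. f x)\<bar>
    \<le> h * (LINT x:{0<..real K * h}|lborel. \<bar>f' x\<bar>)"
proof (induction K)
  case 0
  then show ?case by (simp add: set_lebesgue_integral_def)
next
  case (Suc K)
  let ?a = "real K * h" and ?b = "real (Suc K) * h"
  let ?V = "LINT x:{?a<..?b}|lborel. \<bar>f' x\<bar>"
  have ab: "0 \<le> ?a" "?a \<le> ?b" and len: "?b - ?a = h" using h by (auto simp: algebra_simps)
  have fab: "set_integrable lborel {?a<..?b} f"
    by (rule set_integrable_subset[OF f]) (use ab in auto)
  have const: "set_integrable lborel {?a<..?b} (\<lambda>_. c)" for c :: real
    using ab by (simp add: set_integrable_def)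
  have LINT_const: "(LINT x:{?a<..?b}|lborel. c) = h * c" for c :: real
    using ab len by (simp add: set_lebesgue_integral_def)
  have "\<bar>h * f ?b - (LINT x:{?a<..?b}|lborel. f x)\<bar> = \<bar>LINT x:{?a<..?b}|lborel. f ?b - f x\<bar>"
    by (simp only: set_integral_diff[OF const fab] LINT_const)
  also have "\<dots> \<le> (LINT x:{?a<..?b}|lborel. \<bar>f ?b - f x\<bar>)"
    by (rule abs_set_integral_le)
  also have "\<dots> \<le> (LINT x:{?a<..?b}|lborel. ?V)"
  proof (rule set_integral_mono)
    show "set_integrable lborel {?a<..?b} (\<lambda>x. \<bar>f ?b - f x\<bar>)"
      by (intro set_integrable_abs set_integral_diff const fab)
    show "\<bar>f ?b - f x\<bar> \<le> ?V" if "x \<in> {?a<..?b}" for x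
      using that ab by (intro abs_increment_le_integral_deriv[OF der f']) auto
  qed (rule const)
  also have "\<dots> = h * ?V" by (rule LINT_const)
  finally have step: "\<bar>h * f ?b - (LINT x:{?a<..?b}|lborel. f x)\<bar> \<le> h * ?V" .
  have "(LINT x:{0<..?b}|lborel. \<bar>f' x\<bar>) = (LINT x:{0<..?a}|lborel. \<bar>f' x\<bar>) + ?V"
    by (rule set_integral_half_line_split[OF set_integrable_abs[OF f'] ab])
  moreover have "(LINT x:{0<..?b}|lborel. f x)
      = (LINT x:{0<..?a}|lborel. f x) + (LINT x:{?a<..?b}|lborel. f x)"
    by (rule set_integral_half_line_split[OF f ab])
  moreover have "(\<Sum>k = 1..Suc K. h * f (real k * h)) = (\<Sum>k = 1..K. h * f (real k * h)) + h * f ?b"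
    by simp
  ultimately show ?case
    using Suc.IH step by (simp only: distrib_left)
qed

text \<open>Neighbouring terms have opposite signs, so each pair costs only the variation of
  \<open>f\<close> between its nodes. Induction in steps of two adds one pair at a time;
  \<open>B\<close> pays for the unpaired first term when \<open>K\<close> is odd. The bound does not
  grow as \<open>h\<close> shrinks, so multiplying it by \<open>h\<close> gives an error of order
  \<open>h\<close>.\<close>

lemma alternating_sum_bound:
  fixes f f' :: "real \<Rightarrow> real"
  assumes der: "\<And>x. x > 0 \<Longrightarrow> (f has_real_derivative f' x) (at x)"
    and f': "set_integrable lborel {0<..} f'"
    and B: "\<And>x. x > 0 \<Longrightarrow> \<bar>f x\<bar> \<le> B" and h: "h > 0"
  shows "\<bar>\<Sum>k = 1..K. (-1) ^ k * f (real k * h)\<bar> \<le> B + (LINT x:{0<..real K * h}|lborel. \<bar>f' x\<bar>)"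
proof -
  have B0: "0 \<le> B" using B[of 1] by simp
  show ?thesis
  proof (induction K rule: induct_nat_012)
    case 0
    show ?case using B0 by (simp add: set_lebesgue_integral_def)
  next
    case 1
    show ?case using B[OF h] set_integral_abs_nonneg[of lborel "{0<..h}" f'] by simp
  next
    case (ge2 K)
    let ?a = "real K * h" and ?b = "real (Suc K) * h" and ?c = "real (Suc (Suc K)) * h"
    have ord: "0 \<le> ?a" "?a < ?b" "?b \<le> ?c" "?a \<le> ?c" using h by (auto simp: algebra_simps)
    have "(\<Sum>k = 1..Suc (Suc K). (-1) ^ k * f (real k * h))
        = (\<Sum>k = 1..K. (-1) ^ k * f (real k * h)) + (-1) ^ K * (f ?c - f ?b)"
      by (simp add: algebra_simps)
    moreover have "\<bar>(-1) ^ K * (f ?c - f ?b)\<bar> \<le> (LINT x:{?a<..?c}|lborel. \<bar>f' x\<bar>)"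
      using abs_increment_le_integral_deriv[OF der f' ord(1-3) order_refl]
      by (simp add: abs_mult power_abs)
    ultimately show ?case
      using ge2.IH(1) set_integral_half_line_split[OF set_integrable_abs[OF f'] ord(1,4)]
      by linarith
  qed
qed

text \<open>Differentiating the cosine factor costs at most \<open>R\<close> times |f|. The
  resulting bound is independent of the phase, of the cut-off \<open>b\<close> and of the frequency
  within [-R, R], which later gives uniformity in s and t.\<close>

lemma modulated_deriv:
  fixes f f' :: "real \<Rightarrow> real" and \<sigma> \<alpha> R :: real
  assumes der: "\<And>x. x > 0 \<Longrightarrow> (f has_real_derivative f' x) (at x)"
    and f: "set_integrable lborel {0<..} f" and f': "set_integrable lborel {0<..} f'"
    and R: "\<bar>\<sigma>\<bar> \<le> R"
  defines "g \<equiv> \<lambda>x. f x * cos (x * \<sigma> + \<alpha>)"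
    and "g' \<equiv> \<lambda>x. f' x * cos (x * \<sigma> + \<alpha>) - f x * sin (x * \<sigma> + \<alpha>) * \<sigma>"
  shows "\<And>x. x > 0 \<Longrightarrow> (g has_real_derivative g' x) (at x)"
    and "set_integrable lborel {0<..} g" and "set_integrable lborel {0<..} g'"
    and "(LINT x:{0<..b}|lborel. \<bar>g' x\<bar>)
      \<le> (LINT x:{0<..}|lborel. \<bar>f' x\<bar>) + R * (LINT x:{0<..}|lborel. \<bar>f x\<bar>)"
proof -
  show "(g has_real_derivative g' x) (at x)" if "x > 0" for x
    unfolding g_def g'_def using that
    by (auto intro!: derivative_eq_intros der simp: algebra_simps)
  show "set_integrable lborel {0<..} g"
    unfolding g_def by (rule set_integrable_mult_bounded[OF f, where B = 1]) auto
  show g': "set_integrable lborel {0<..} g'"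
    unfolding g'_def
    by (intro set_integral_diff set_integrable_mult_left set_integrable_mult_bounded[where B = 1] f f')
       auto
  have "(LINT x:{0<..b}|lborel. \<bar>g' x\<bar>) \<le> (LINT x:{0<..}|lborel. \<bar>g' x\<bar>)"
    by (rule set_integral_abs_mono_set[OF g']) auto
  also have "\<dots> \<le> (LINT x:{0<..}|lborel. \<bar>f' x\<bar> + R * \<bar>f x\<bar>)"
  proof (rule set_integral_mono)
    show "\<bar>g' x\<bar> \<le> \<bar>f' x\<bar> + R * \<bar>f x\<bar>" for x
    proof -
      have "\<bar>f' x * cos (x * \<sigma> + \<alpha>)\<bar> \<le> \<bar>f' x\<bar>"
        by (simp add: abs_mult mult_left_le)
      moreover have "\<bar>f x * sin (x * \<sigma> + \<alpha>) * \<sigma>\<bar> \<le> \<bar>f x\<bar> * 1 * R"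
        unfolding abs_mult using R by (intro mult_mono) auto
      ultimately show ?thesis unfolding g'_def by (simp add: mult.commute)
    qed
  qed (use f f' g' in \<open>auto intro!: set_integral_add set_integrable_abs\<close>)
  also have "\<dots> = (LINT x:{0<..}|lborel. \<bar>f' x\<bar>) + R * (LINT x:{0<..}|lborel. \<bar>f x\<bar>)"
    using f f' by (subst set_integral_add) (auto intro!: set_integrable_abs)
  finally show "(LINT x:{0<..b}|lborel. \<bar>g' x\<bar>)
      \<le> (LINT x:{0<..}|lborel. \<bar>f' x\<bar>) + R * (LINT x:{0<..}|lborel. \<bar>f x\<bar>)" .
qed

text \<open>Three errors are added: the Riemann sum of the first cosine, the alternating sum of the
  second, and the integral beyond the last node. The first two each contribute one copy of
  \<open>?J\<close>, whence the factor 2. In the application the two frequencies are s - t and s +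
  t.\<close>

lemma cosine_quadrature_error:
  fixes f f' :: "real \<Rightarrow> real"
  assumes der: "\<And>x. x > 0 \<Longrightarrow> (f has_real_derivative f' x) (at x)"
    and f: "set_integrable lborel {0<..} f" and f': "set_integrable lborel {0<..} f'"
    and B: "\<And>x. x > 0 \<Longrightarrow> \<bar>f x\<bar> \<le> B" and h: "h > 0"
    and \<sigma>: "\<bar>\<sigma>\<bar> \<le> R" and \<rho>: "\<bar>\<rho>\<bar> \<le> R"
  shows "\<bar>(\<Sum>k = 1..K. h * (f (real k * h) *
        (cos (real k * h * \<sigma> + \<alpha>) - (-1) ^ k * cos (real k * h * \<rho> + \<beta>))))
      - (LINT x:{0<..}|lborel. f x * cos (x * \<sigma> + \<alpha>))\<bar>
    \<le> h * (B + 2 * ((LINT x:{0<..}|lborel. \<bar>f' x\<bar>) + R * (LINT x:{0<..}|lborel. \<bar>f x\<bar>)))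
      + (LINT x:{real K * h<..}|lborel. \<bar>f x\<bar>)"
proof -
  let ?J = "(LINT x:{0<..}|lborel. \<bar>f' x\<bar>) + R * (LINT x:{0<..}|lborel. \<bar>f x\<bar>)"
  let ?g = "\<lambda>x. f x * cos (x * \<sigma> + \<alpha>)" and ?e = "\<lambda>x. f x * cos (x * \<rho> + \<beta>)"
  note g = modulated_deriv[OF der f f' \<sigma>, where \<alpha> = \<alpha>]
  note e = modulated_deriv[OF der f f' \<rho>, where \<alpha> = \<beta>]
  have 1: "\<bar>(\<Sum>k = 1..K. h * ?g (real k * h)) - (LINT x:{0<..real K * h}|lborel. ?g x)\<bar> \<le> h * ?J"
    using riemann_sum_error[OF g(1-3) h, of K] mult_left_mono[OF g(4)[of "real K * h"], of h] h
    by linarith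
  have "\<bar>?e x\<bar> \<le> B" if "x > 0" for x
  proof -
    have "\<bar>?e x\<bar> \<le> \<bar>f x\<bar>" by (simp add: abs_mult mult_left_le)
    then show ?thesis using B[OF that] by linarith
  qed
  then have "\<bar>\<Sum>k = 1..K. (-1) ^ k * ?e (real k * h)\<bar> \<le> B + ?J"
    using alternating_sum_bound[OF e(1,3) _ h, of B K] e(4)[of "real K * h"] by force
  then have 2: "\<bar>h * (\<Sum>k = 1..K. (-1) ^ k * ?e (real k * h))\<bar> \<le> h * (B + ?J)"
    using h by (simp add: abs_mult)
  have "(LINT x:{0<..}|lborel. ?g x)
      = (LINT x:{0<..real K * h}|lborel. ?g x) + (LINT x:{real K * h<..}|lborel. ?g x)"
  proof -
    have "{0<..} = {0<..real K * h} \<union> {real K * h<..}"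
      using h by (auto simp: not_le intro: le_less_trans[rotated])
    moreover have "set_integrable lborel {0<..real K * h} ?g" "set_integrable lborel {real K * h<..} ?g"
      using h by (auto intro!: set_integrable_subset[OF g(2)] intro: le_less_trans[rotated])
    moreover have "{0<..real K * h} \<inter> {real K * h<..} = {}" by auto
    ultimately show ?thesis by (simp only: set_integral_Un)
  qed
  moreover have "\<bar>LINT x:{real K * h<..}|lborel. ?g x\<bar> \<le> (LINT x:{real K * h<..}|lborel. \<bar>f x\<bar>)"
  proof -
    have sub: "{real K * h<..} \<subseteq> {0<..}" using h by (auto intro: le_less_trans[rotated])
    have "\<bar>LINT x:{real K * h<..}|lborel. ?g x\<bar> \<le> (LINT x:{real K * h<..}|lborel. \<bar>?g x\<bar>)"
      by (rule abs_set_integral_le)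
    also have "\<dots> \<le> (LINT x:{real K * h<..}|lborel. \<bar>f x\<bar>)"
      using sub f g(2) by (intro set_integral_mono set_integrable_abs)
        (auto intro: set_integrable_subset simp: abs_mult mult_left_le)
    finally show ?thesis .
  qed
  moreover have "(\<Sum>k = 1..K. h * (f (real k * h) *
        (cos (real k * h * \<sigma> + \<alpha>) - (-1) ^ k * cos (real k * h * \<rho> + \<beta>))))
      = (\<Sum>k = 1..K. h * ?g (real k * h)) - h * (\<Sum>k = 1..K. (-1) ^ k * ?e (real k * h))"
    by (simp add: sum_distrib_left sum_subtractf algebra_simps)
  ultimately show ?thesis using 1 2 unfolding distrib_left by linarith
qed

text \<open>Dominated convergence: each fixed point eventually leaves the tail, and |f| on the
  half-line is the majorant.\<close>

lemma tendsto_set_integral_tail: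
  fixes f :: "real \<Rightarrow> real"
  assumes "set_integrable lborel {0<..} f"
  shows "((\<lambda>y. LINT x:{y<..}|lborel. \<bar>f x\<bar>) \<longlongrightarrow> 0) at_top"
proof -
  let ?f = "\<lambda>x. indicator {0<..} x *\<^sub>R f x"
  have int: "integrable lborel ?f" using assms by (simp add: set_integrable_def)
  have [measurable]: "?f \<in> borel_measurable lborel"
    using int by (rule borel_measurable_integrable)
  have "((\<lambda>y. LINT x|lborel. indicator {y<..} x * \<bar>?f x\<bar>) \<longlongrightarrow> (LINT x::real|lborel. (0::real))) at_top"
  proof (rule integral_dominated_convergence_at_top)
    show "integrable lborel (\<lambda>x. \<bar>?f x\<bar>)" using int by (rule integrable_abs)
    show "AE x in lborel. ((\<lambda>y. indicator {y<..} x * \<bar>?f x\<bar>) \<longlongrightarrow> 0) at_top"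
    proof (rule AE_I2)
      fix x
      have "eventually (\<lambda>y. indicator {y<..} x * \<bar>?f x\<bar> = 0) at_top"
        using eventually_ge_at_top[of x] by eventually_elim (auto simp: indicator_def)
      then show "((\<lambda>y. indicator {y<..} x * \<bar>?f x\<bar>) \<longlongrightarrow> 0) at_top"
        by (rule tendsto_eventually)
    qed
    show "\<forall>\<^sub>F y in at_top. AE x in lborel. norm (indicator {y<..} x * \<bar>?f x\<bar>) \<le> \<bar>?f x\<bar>"
      by (intro always_eventually allI AE_I2) (auto simp: indicator_def)
  qed measurable
  moreover have "eventually (\<lambda>y. (LINT x|lborel. indicator {y<..} x * \<bar>?f x\<bar>)
      = (LINT x:{y<..}|lborel. \<bar>f x\<bar>)) at_top"
    using eventually_ge_at_top[of 0]
  proof eventually_elim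
    case (elim y)
    then show ?case
      unfolding set_lebesgue_integral_def
      by (intro Bochner_Integration.integral_cong) (auto simp: indicator_def)
  qed
  ultimately show ?thesis by (simp add: tendsto_cong)
qed

section \<open>Mixed derivatives of the two kernels\<close>

definition cosine_transform :: "(real \<Rightarrow> real) \<Rightarrow> real \<Rightarrow> real \<Rightarrow> real" where
  "cosine_transform f \<alpha> \<tau> = (LINT \<omega>:{0<..}|lborel. f \<omega> * cos (\<omega> * \<tau> + \<alpha>))"

lemma continuous_cosine_transform:
  assumes f: "set_integrable lborel {0<..} f"
  shows "continuous_on UNIV (cosine_transform f \<alpha>)"
proof -
  let ?f = "\<lambda>x. indicator {0<..} x *\<^sub>R f x"
  have int: "integrable lborel ?f" using f by (simp add: set_integrable_def)
  have [measurable]: "?f \<in> borel_measurable lborel"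
    using int by (rule borel_measurable_integrable)
  have "(\<lambda>i. LINT x|lborel. ?f x * cos (x * u i + \<alpha>)) \<longlonglongrightarrow> (LINT x|lborel. ?f x * cos (x * \<tau> + \<alpha>))"
    if "u \<longlonglongrightarrow> \<tau>" for u \<tau>
  proof (rule integral_dominated_convergence)
    show "integrable lborel (\<lambda>x. \<bar>?f x\<bar>)" using int by (rule integrable_abs)
    show "AE x in lborel. (\<lambda>i. ?f x * cos (x * u i + \<alpha>)) \<longlonglongrightarrow> ?f x * cos (x * \<tau> + \<alpha>)"
      by (intro AE_I2 tendsto_intros that)
    show "AE x in lborel. norm (?f x * cos (x * u i + \<alpha>)) \<le> \<bar>?f x\<bar>" for i
      by (intro AE_I2) (simp add: abs_mult mult_left_le)
  qed measurable
  then show ?thesis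
    unfolding cosine_transform_def set_lebesgue_integral_def continuous_on_sequentially
    by (simp add: comp_def mult.assoc)
qed

text \<open>Dominated convergence for difference quotients: cosine is 1-Lipschitz, so the quotient
  in \<tau> is at most |x| and |x f(x)| is an integrable majorant. Since -sin y = cos(y + pi/2), the
  derivative is again a cosine transform, with one more weight and a shifted phase.\<close>

lemma has_real_derivative_cosine_transform:
  assumes f: "set_integrable lborel {0<..} f"
    and f1: "set_integrable lborel {0<..} (\<lambda>\<omega>. \<omega> * f \<omega>)"
  shows "(cosine_transform f \<alpha> has_real_derivative
    cosine_transform (\<lambda>\<omega>. \<omega> * f \<omega>) (\<alpha> + pi / 2) \<tau>) (at \<tau>)"
  unfolding DERIV_def tendsto_at_iff_sequentially comp_def
proof (intro allI impI)
  fix u :: "nat \<Rightarrow> real"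
  assume u_ne: "\<forall>i. u i \<in> UNIV - {0}" and u: "u \<longlonglongrightarrow> 0"
  let ?f = "\<lambda>x. indicator {0<..} x *\<^sub>R f x"
  let ?f1 = "\<lambda>x. indicator {0<..} x *\<^sub>R (x * f x)"
  let ?c = "\<lambda>\<tau> x. cos (x * \<tau> + \<alpha>)"
  have int: "integrable lborel ?f" using f by (simp add: set_integrable_def)
  have int1: "integrable lborel ?f1" using f1 by (simp add: set_integrable_def)
  have [measurable]: "?f \<in> borel_measurable lborel" "?f1 \<in> borel_measurable lborel"
    using int int1 by (auto intro: borel_measurable_integrable)
  have "(\<lambda>i. LINT x|lborel. ?f x * ((?c (\<tau> + u i) x - ?c \<tau> x) / u i))
      \<longlonglongrightarrow> (LINT x|lborel. ?f1 x * cos (x * \<tau> + (\<alpha> + pi / 2)))"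
  proof (rule integral_dominated_convergence)
    show "integrable lborel (\<lambda>x. \<bar>?f1 x\<bar>)" using int1 by (rule integrable_abs)
    show "AE x in lborel. (\<lambda>i. ?f x * ((?c (\<tau> + u i) x - ?c \<tau> x) / u i))
        \<longlonglongrightarrow> ?f1 x * cos (x * \<tau> + (\<alpha> + pi / 2))"
    proof (rule AE_I2)
      fix x
      have "((\<lambda>\<tau>. ?c \<tau> x) has_real_derivative x * cos (x * \<tau> + (\<alpha> + pi / 2))) (at \<tau>)"
        by (auto intro!: derivative_eq_intros simp: cos_add sin_add algebra_simps)
      then have "(\<lambda>i. (?c (\<tau> + u i) x - ?c \<tau> x) / u i) \<longlonglongrightarrow> x * cos (x * \<tau> + (\<alpha> + pi / 2))"
        using u u_ne unfolding DERIV_def tendsto_at_iff_sequentially comp_def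
        by auto
      then have "(\<lambda>i. ?f x * ((?c (\<tau> + u i) x - ?c \<tau> x) / u i))
          \<longlonglongrightarrow> ?f x * (x * cos (x * \<tau> + (\<alpha> + pi / 2)))"
        by (rule tendsto_mult_left)
      then show "(\<lambda>i. ?f x * ((?c (\<tau> + u i) x - ?c \<tau> x) / u i))
          \<longlonglongrightarrow> ?f1 x * cos (x * \<tau> + (\<alpha> + pi / 2))"
        by (simp add: mult_ac)
    qed
    show "AE x in lborel. norm (?f x * ((?c (\<tau> + u i) x - ?c \<tau> x) / u i)) \<le> \<bar>?f1 x\<bar>" for i
    proof (rule AE_I2)
      fix x
      have "\<bar>?c (\<tau> + u i) x - ?c \<tau> x\<bar> \<le> \<bar>x * u i\<bar>"
      proof -
        have "\<bar>cos b - cos a\<bar> \<le> \<bar>b - a\<bar>" for a b :: real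
        proof -
          have "norm (cos b - cos a) \<le> 1 * norm (b - a)"
            by (rule field_differentiable_bound[of UNIV cos "\<lambda>x. - sin x"])
              (auto intro!: derivative_eq_intros)
          then show ?thesis by simp
        qed
        from this[of "x * (\<tau> + u i) + \<alpha>" "x * \<tau> + \<alpha>"] show ?thesis
          by (simp add: algebra_simps)
      qed
      then have "\<bar>(?c (\<tau> + u i) x - ?c \<tau> x) / u i\<bar> \<le> \<bar>x\<bar>"
        using u_ne by (simp add: abs_mult divide_le_eq)
      from mult_left_mono[OF this, of "\<bar>?f x\<bar>"]
      show "norm (?f x * ((?c (\<tau> + u i) x - ?c \<tau> x) / u i)) \<le> \<bar>?f1 x\<bar>"
        by (simp add: abs_mult mult_ac)
    qed
  qed measurable
  moreover have "(LINT x|lborel. ?f x * ((?c (\<tau> + u i) x - ?c \<tau> x) / u i))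
      = (cosine_transform f \<alpha> (\<tau> + u i) - cosine_transform f \<alpha> \<tau>) / u i" for i
  proof -
    have "set_integrable lborel {0<..} (\<lambda>x. f x * ?c v x)" for v
      by (rule set_integrable_mult_bounded[OF f, where B = 1]) auto
    then have int': "integrable lborel (\<lambda>x. ?f x * ?c v x)" for v
      by (simp add: set_integrable_def mult.assoc)
    have "(LINT x|lborel. ?f x * ((?c (\<tau> + u i) x - ?c \<tau> x) / u i))
        = (LINT x|lborel. (?f x * ?c (\<tau> + u i) x - ?f x * ?c \<tau> x) / u i)"
      by (simp add: right_diff_distrib)
    also have "\<dots> = ((LINT x|lborel. ?f x * ?c (\<tau> + u i) x) - (LINT x|lborel. ?f x * ?c \<tau> x)) / u i"
      using int' by (simp add: Bochner_Integration.integral_diff)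
    finally show ?thesis
      by (simp add: cosine_transform_def set_lebesgue_integral_def mult.assoc)
  qed
  ultimately have "(\<lambda>i. (cosine_transform f \<alpha> (\<tau> + u i) - cosine_transform f \<alpha> \<tau>) / u i)
      \<longlonglongrightarrow> (LINT x|lborel. ?f1 x * cos (x * \<tau> + (\<alpha> + pi / 2)))"
    by (simp only:)
  then show "(\<lambda>i. (cosine_transform f \<alpha> (\<tau> + u i) - cosine_transform f \<alpha> \<tau>) / u i)
      \<longlonglongrightarrow> cosine_transform (\<lambda>\<omega>. \<omega> * f \<omega>) (\<alpha> + pi / 2) \<tau>"
    by (simp add: cosine_transform_def set_lebesgue_integral_def mult.assoc)
qed

text \<open>Each derivative of cos(\<omega>(s - t)) in s adds pi/2 to the phase, each derivative in t subtracts it.\<close>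

definition kernel_derivs :: "(real \<Rightarrow> real) \<Rightarrow> nat \<Rightarrow> nat \<Rightarrow> real \<Rightarrow> real \<Rightarrow> real" where
  "kernel_derivs S a b s t =
     1 / pi * cosine_transform (\<lambda>\<omega>. \<omega> ^ (a + b) * S \<omega>) ((real a - real b) * (pi / 2)) (s - t)"

lemma deriv_family_kernel_derivs:
  assumes int: "\<And>n. n \<le> 2 * r \<Longrightarrow> set_integrable lborel {0<..} (\<lambda>\<omega>. \<omega> ^ n * S \<omega>)"
  shows "deriv_family t0 t1 r (kernel_derivs S)"
proof -
  define G where "G = (\<lambda>n \<alpha>. cosine_transform (\<lambda>\<omega>. \<omega> ^ n * S \<omega>) \<alpha>)"
  have der: "(G n \<alpha> has_real_derivative G (Suc n) (\<alpha> + pi / 2) \<tau>) (at \<tau>)" if "n < 2 * r" for n \<alpha> \<tau>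
    using has_real_derivative_cosine_transform[OF int[of n], of \<alpha> \<tau>] int[of "Suc n"] that
    by (simp add: G_def mult.assoc)
  have G: "kernel_derivs S a b s t = 1 / pi * G (a + b) ((real a - real b) * (pi / 2)) (s - t)"
    for a b s t by (simp add: kernel_derivs_def G_def)
  \<comment> \<open>Differentiating s - t in t produces the factor -1. A phase change by pi absorbs
    it and turns the shift +pi/2 into -pi/2.\<close>
  have shift: "G n (\<alpha> + pi) \<tau> = - G n \<alpha> \<tau>" for n \<alpha> \<tau>
    by (simp add: G_def cosine_transform_def set_lebesgue_integral_def add.assoc[symmetric])
  show ?thesis
    unfolding deriv_family_def
  proof (intro conjI allI impI ballI)
    fix a b assume "a \<le> r" "b \<le> r"
    then have "continuous_on UNIV (G (a + b) \<alpha>)" for \<alpha>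
      unfolding G_def by (intro continuous_cosine_transform int) simp
    then have "continuous_on ({t0..t1} \<times> {t0..t1}) (\<lambda>x. G (a + b) \<alpha> (fst x - snd x))" for \<alpha>
      by (rule continuous_on_compose2) (auto intro!: continuous_intros)
    then show "continuous_on ({t0..t1} \<times> {t0..t1}) (\<lambda>(s, t). kernel_derivs S a b s t)"
      unfolding G case_prod_beta by (intro continuous_intros)
  next
    fix a b s t assume ab: "a < r" "b \<le> r"
    have "(real (Suc a) - real b) * (pi / 2) = (real a - real b) * (pi / 2) + pi / 2"
      by (simp add: field_simps)
    then have "((\<lambda>u. G (a + b) ((real a - real b) * (pi / 2)) (u - t)) has_real_derivative
        G (Suc (a + b)) ((real (Suc a) - real b) * (pi / 2)) (s - t) * 1) (at s within {t0..t1})"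
      using ab by (simp only:) (intro DERIV_chain2[OF der] derivative_eq_intros, auto)
    from DERIV_cmult[OF this, of "1 / pi"]
    show "((\<lambda>u. kernel_derivs S a b u t) has_real_derivative kernel_derivs S (Suc a) b s t)
        (at s within {t0..t1})"
      unfolding G add_Suc mult_1_right .
  next
    fix a b s t assume ab: "a \<le> r" "b < r"
    have "(real a - real b) * (pi / 2) + pi / 2 = (real a - real (Suc b)) * (pi / 2) + pi"
      by (simp add: field_simps)
    then have "G (Suc (a + b)) ((real a - real b) * (pi / 2) + pi / 2) (s - t) * (- 1)
        = G (Suc (a + b)) ((real a - real (Suc b)) * (pi / 2)) (s - t)"
      by (simp only: shift)
    moreover have "((\<lambda>v. G (a + b) ((real a - real b) * (pi / 2)) (s - v)) has_real_derivative
        G (Suc (a + b)) ((real a - real b) * (pi / 2) + pi / 2) (s - t) * (- 1)) (at t within {t0..t1})"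
      using ab by (intro DERIV_chain2[OF der] derivative_eq_intros) auto
    ultimately have "((\<lambda>v. G (a + b) ((real a - real b) * (pi / 2)) (s - v)) has_real_derivative
        G (Suc (a + b)) ((real a - real (Suc b)) * (pi / 2)) (s - t)) (at t within {t0..t1})"
      by (simp only:)
    from DERIV_cmult[OF this, of "1 / pi"]
    show "((\<lambda>v. kernel_derivs S a b s v) has_real_derivative kernel_derivs S a (Suc b) s t)
        (at t within {t0..t1})"
      unfolding G add_Suc_right .
  qed
qed

text \<open>Take real parts in the inversion formula; evenness of \<open>S\<close> folds the
  integral over the line onto the half-line, so 1/(2 pi) becomes 1/pi.\<close>

lemma stationary_kernel_eq:
  assumes "has_spectral_density C S"
  shows "stationary_kernel C = kernel_derivs S 0 0"
proof -
  have S: "integrable lborel S" and even: "S (- \<omega>) = S \<omega>"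
    and inversion: "complex_of_real (C \<tau>) = 1 / (2 * complex_of_real pi) *
      (LINT \<omega>|lborel. complex_of_real (S \<omega>) * exp (\<i> * complex_of_real (\<omega> * \<tau>)))" for \<omega> \<tau>
    using assms unfolding has_spectral_density_def by blast+
  have "C \<tau> = 1 / pi * cosine_transform S 0 \<tau>" for \<tau>
  proof -
    let ?g = "\<lambda>\<omega>. S \<omega> * cos (\<omega> * \<tau>)"
    let ?z = "\<lambda>\<omega>. complex_of_real (S \<omega>) * exp (\<i> * complex_of_real (\<omega> * \<tau>))"
    have [measurable]: "S \<in> borel_measurable lborel"
      using S by (rule borel_measurable_integrable)
    have "set_integrable lborel UNIV (\<lambda>\<omega>. S \<omega> * cos (\<omega> * \<tau>))"
      by (rule set_integrable_mult_bounded[where B = 1]) (use S in \<open>auto simp: set_integrable_def\<close>)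
    then have g: "integrable lborel ?g" by (simp add: set_integrable_def)
    have z: "integrable lborel ?z"
    proof (rule Bochner_Integration.integrable_bound[OF S])
      show "?z \<in> borel_measurable lborel" by measurable
      show "AE \<omega> in lborel. norm (?z \<omega>) \<le> norm (S \<omega>)"
        by (intro AE_I2) (simp add: norm_mult)
    qed
    have "complex_of_real (C \<tau>) = complex_of_real (1 / (2 * pi)) * (LINT \<omega>|lborel. ?z \<omega>)"
      using inversion[of \<tau>] by simp
    then have "Re (complex_of_real (C \<tau>)) = Re (complex_of_real (1 / (2 * pi)) * (LINT \<omega>|lborel. ?z \<omega>))"
      by simp
    then have "C \<tau> = 1 / (2 * pi) * Re (LINT \<omega>|lborel. ?z \<omega>)"
      by (simp only: Re_complex_of_real Im_complex_of_real times_complex.sel)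
    also have "Re (LINT \<omega>|lborel. ?z \<omega>) = (LINT \<omega>|lborel. ?g \<omega>)"
      by (subst integral_Re[OF z, symmetric]) (simp add: Re_exp)
    also have "(LINT \<omega>|lborel. ?g \<omega>) = 2 * (LINT \<omega>:{0<..}|lborel. ?g \<omega>)"
    proof -
      have set_int: "set_integrable lborel A ?g" if "A \<in> sets borel" for A
        using g that unfolding set_integrable_def by (intro integrable_mult_indicator) auto
      have "(LINT \<omega>:{..<0}|lborel. ?g \<omega>) = (LINT \<omega>:{0<..}|lborel. ?g \<omega>)"
        unfolding set_lebesgue_integral_def
        by (subst lborel_integral_real_affine[where c = "-1" and t = 0])
          (auto intro!: Bochner_Integration.integral_cong simp: even indicator_def)
      \<comment> \<open>The line differs from the union of the two open half-lines by the null set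
        {0}.\<close>
      moreover have "(LINT \<omega>|lborel. ?g \<omega>) = (LINT \<omega>:{..<0} \<union> {0<..}|lborel. ?g \<omega>)"
        unfolding set_lebesgue_integral_def
      proof (rule integral_cong_AE)
        show "AE \<omega> in lborel. ?g \<omega> = indicator ({..<0} \<union> {0<..}) \<omega> *\<^sub>R ?g \<omega>"
          using AE_lborel_singleton[of 0]
          by eventually_elim (auto simp: indicator_def)
      qed measurable
      moreover have "(LINT \<omega>:{..<0} \<union> {0<..}|lborel. ?g \<omega>)
          = (LINT \<omega>:{..<0}|lborel. ?g \<omega>) + (LINT \<omega>:{0<..}|lborel. ?g \<omega>)"
        by (intro set_integral_Un set_int) auto
      ultimately show ?thesis by simp
    qed
    finally show ?thesis by (simp add: cosine_transform_def)
  qed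
  then show ?thesis by (simp add: fun_eq_iff stationary_kernel_def kernel_derivs_def)
qed

section \<open>The sine-basis approximation and its mixed derivatives\<close>

definition basis_deriv :: "nat \<Rightarrow> nat \<Rightarrow> real \<Rightarrow> real \<Rightarrow> real" where
  "basis_deriv a k L t = L powr (- 1 / 2) * (real k * pi / (2 * L)) ^ a *
     sin (real k * pi / (2 * L) * (t + L) + real a * (pi / 2))"

definition approx_derivs ::
  "(real \<Rightarrow> real) \<Rightarrow> real \<Rightarrow> nat \<Rightarrow> nat \<Rightarrow> nat \<Rightarrow> real \<Rightarrow> real \<Rightarrow> real" where
  "approx_derivs S L K a b s t =
     (\<Sum>k = 1..K. S (real k * pi / (2 * L)) * basis_deriv a k L s * basis_deriv b k L t)"

lemma approx_kernel_eq: "approx_kernel S L K = approx_derivs S L K 0 0"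
  by (simp add: fun_eq_iff approx_kernel_def approx_derivs_def basis_deriv_def basis_fun_def)

lemma has_real_derivative_basis_deriv:
  "(basis_deriv a k L has_real_derivative basis_deriv (Suc a) k L t) (at t within A)"
proof -
  have "sin (x + real (Suc a) * (pi / 2)) = cos (x + real a * (pi / 2))" for x
  proof -
    have "x + real (Suc a) * (pi / 2) = (x + real a * (pi / 2)) + pi / 2"
      by (simp add: field_simps)
    then show ?thesis by (simp only: sin_add) simp
  qed
  \<comment> \<open>For \<open>L = 0\<close> both functions vanish, because \<open>0 powr x\<close>
    is 0.\<close>
  then show ?thesis
    unfolding basis_deriv_def by (cases "L = 0") (auto intro!: derivative_eq_intros)
qed

lemma deriv_family_approx_derivs: "deriv_family t0 t1 r (approx_derivs S L K)"
proof -
  have cont: "continuous_on A (basis_deriv a k L)" for A a k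
    by (rule DERIV_continuous_on) (rule has_real_derivative_basis_deriv)
  show ?thesis
    unfolding deriv_family_def approx_derivs_def
  proof (intro conjI allI impI ballI)
    show "continuous_on ({t0..t1} \<times> {t0..t1}) (\<lambda>(s, t). \<Sum>k = 1..K.
        S (real k * pi / (2 * L)) * basis_deriv a k L s * basis_deriv b k L t)" for a b
      unfolding case_prod_beta
      by (intro continuous_intros continuous_on_compose2[OF cont]) auto
  qed (auto intro!: derivative_eq_intros has_real_derivative_basis_deriv simp: ac_simps)
qed

text \<open>Product-to-sum formula: in the difference of the two sine arguments the shift by
  \<open>L\<close> cancels, while in their sum it contributes k pi and hence the sign (-1)^k. The
  normalisation 1/L = 2h/pi, halved by the formula, supplies the step \<open>h\<close> of a Riemann
  sum.\<close>

lemma approx_derivs_eq: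
  assumes "L > 0"
  defines "h \<equiv> pi / (2 * L)"
  shows "approx_derivs S L K a b s t = 1 / pi * (\<Sum>k = 1..K. h * ((real k * h) ^ (a + b) * S (real k * h) *
    (cos (real k * h * (s - t) + (real a - real b) * (pi / 2)) -
     (-1) ^ k * cos (real k * h * (s + t) + (real a + real b) * (pi / 2)))))"
  unfolding approx_derivs_def sum_distrib_left
proof (rule sum.cong[OF refl])
  fix k
  let ?w = "real k * h"
  let ?x = "?w * (s + L) + real a * (pi / 2)" and ?y = "?w * (t + L) + real b * (pi / 2)"
  have w: "real k * pi / (2 * L) = ?w" by (simp add: h_def)
  have "L powr (- 1 / 2) * L powr (- 1 / 2) = 1 / L"
    using assms(1) by (simp add: powr_minus_divide flip: powr_add)
  then have LL: "L powr (- 1 / 2) * L powr (- 1 / 2) = 2 * (1 / pi * h)"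
    by (simp add: h_def)
  have "?x + ?y = (?w * (s + t) + (real a + real b) * (pi / 2)) + ?w * (2 * L)"
    by (simp add: algebra_simps)
  also have "?w * (2 * L) = pi * real k" using assms(1) by (simp add: h_def)
  finally have xy: "?x + ?y = (?w * (s + t) + (real a + real b) * (pi / 2)) + pi * real k" .
  have "cos (?x + ?y) = (-1) ^ k * cos (?w * (s + t) + (real a + real b) * (pi / 2))"
    unfolding xy by (simp only: cos_add cos_npi2 sin_npi2) simp
  moreover have "?x - ?y = ?w * (s - t) + (real a - real b) * (pi / 2)"
    by (simp add: field_simps)
  ultimately have prod: "sin ?x * sin ?y =
      (cos (?w * (s - t) + (real a - real b) * (pi / 2)) -
       (-1) ^ k * cos (?w * (s + t) + (real a + real b) * (pi / 2))) / 2"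
    by (simp only: sin_times_sin)
  have "S ?w * basis_deriv a k L s * basis_deriv b k L t
      = (L powr (- 1 / 2) * L powr (- 1 / 2)) * (?w ^ (a + b) * S ?w) * (sin ?x * sin ?y)"
    unfolding basis_deriv_def w power_add by (simp only: mult_ac)
  then show "S (real k * pi / (2 * L)) * basis_deriv a k L s * basis_deriv b k L t
      = 1 / pi * (h * (?w ^ (a + b) * S ?w *
        (cos (?w * (s - t) + (real a - real b) * (pi / 2)) -
         (-1) ^ k * cos (?w * (s + t) + (real a + real b) * (pi / 2)))))"
    unfolding w LL prod by simp
qed

section \<open>Convergence\<close>

lemma spectral_regularity_weighted:
  assumes "spectral_regularity r S" "n \<le> 2 * r"
  defines "f \<equiv> \<lambda>\<omega>. \<omega> ^ n * S \<omega>"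
  shows "\<exists>B. \<forall>x>0. \<bar>f x\<bar> \<le> B"
    and "\<And>x. x > 0 \<Longrightarrow> (f has_real_derivative deriv f x) (at x)"
    and "set_integrable lborel {0<..} f" and "set_integrable lborel {0<..} (deriv f)"
proof -
  \<comment> \<open>Every \<open>n\<close> up to \<open>2 * r\<close> splits as a + b with both
    parts at most \<open>r\<close>.\<close>
  have "min n r \<in> {0..r}" "n - min n r \<in> {0..r}" "min n r + (n - min n r) = n"
    using assms(2) by auto
  then have *: "bounded (f ` {0<..})" "\<forall>\<omega>>0. f differentiable (at \<omega>)"
    "set_integrable lborel {0<..} f" "set_integrable lborel {0<..} (deriv f)"
    using assms(1) unfolding spectral_regularity_def f_def Let_def by metis+
  show "\<exists>B. \<forall>x>0. \<bar>f x\<bar> \<le> B"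
    using *(1) unfolding bounded_iff by auto
  show "(f has_real_derivative deriv f x) (at x)" if "x > 0" for x
    using *(2) that by (simp only: DERIV_deriv_iff_real_differentiable)
  show "set_integrable lborel {0<..} f" "set_integrable lborel {0<..} (deriv f)"
    by fact+
qed

lemma filterlim_fst_joint_limit: "filterlim fst at_top joint_limit"
  unfolding joint_limit_def by (rule filterlim_mono[OF filterlim_fst order_refl inf_le1])

lemma filterlim_ratio_joint_limit: "filterlim (\<lambda>(L, K). real K / L) at_top joint_limit"
  unfolding joint_limit_def by (rule filterlim_mono[OF filterlim_filtercomap order_refl inf_le2])

text \<open>The quadrature estimate is applied with frequencies bounded by 2 \<Lambda> and last node
  K h = (K/L)(pi/2). The terms of order \<open>h\<close> vanish as L grows, the tail as K/L
  grows.\<close>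

lemma derivs_error_uniform:
  assumes reg: "spectral_regularity r S"
  shows "\<exists>\<epsilon>. (\<epsilon> \<longlongrightarrow> 0) joint_limit \<and>
    (\<forall>L K a b s t. L > 0 \<longrightarrow> a \<le> r \<longrightarrow> b \<le> r \<longrightarrow> \<bar>s\<bar> \<le> \<Lambda> \<longrightarrow> \<bar>t\<bar> \<le> \<Lambda> \<longrightarrow>
      \<bar>approx_derivs S L K a b s t - kernel_derivs S a b s t\<bar> \<le> \<epsilon> (L, K))"
proof -
  define f where "f = (\<lambda>n \<omega>. \<omega> ^ n * S \<omega>)"
  have f: "\<exists>B. \<forall>x>0. \<bar>f n x\<bar> \<le> B"
    "\<And>x. x > 0 \<Longrightarrow> (f n has_real_derivative deriv (f n) x) (at x)"
    "set_integrable lborel {0<..} (f n)" "set_integrable lborel {0<..} (deriv (f n))"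
    if "n \<le> 2 * r" for n
    unfolding f_def by (fact spectral_regularity_weighted[OF reg that])+
  obtain B where B: "\<And>n x. n \<le> 2 * r \<Longrightarrow> x > 0 \<Longrightarrow> \<bar>f n x\<bar> \<le> B n"
    using f(1) by metis
  define A where "A = (\<lambda>n. \<bar>B n\<bar> + 2 * ((LINT x:{0<..}|lborel. \<bar>deriv (f n) x\<bar>) +
    \<bar>2 * \<Lambda>\<bar> * (LINT x:{0<..}|lborel. \<bar>f n x\<bar>)))"
  define tail where "tail = (\<lambda>n y. LINT x:{y<..}|lborel. \<bar>f n x\<bar>)"
  define E where "E = (\<lambda>n (L, K). 1 / pi * (pi / (2 * L) * A n + tail n (real K / L * (pi / 2))))"
  \<comment> \<open>Summing the nonnegative errors over all total orders \<open>n\<close> gives a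
    single bound that dominates each of them.\<close>
  define \<epsilon> where "\<epsilon> = (\<lambda>x. \<Sum>n\<le>2 * r. E n x)"
  have A_nonneg: "0 \<le> A n" for n
    unfolding A_def by (intro add_nonneg_nonneg mult_nonneg_nonneg set_integral_abs_nonneg) auto
  have E_nonneg: "0 \<le> E n (L, K)" if "L > 0" for n L K
    unfolding E_def tail_def using that A_nonneg
    by (auto intro!: add_nonneg_nonneg mult_nonneg_nonneg divide_nonneg_nonneg set_integral_abs_nonneg)
  have "(E n \<longlongrightarrow> 0) joint_limit" if "n \<le> 2 * r" for n
  proof -
    have "((\<lambda>L. pi / (2 * L) * A n) \<longlongrightarrow> 0) at_top"
      by (auto intro!: tendsto_mult_left_zero tendsto_divide_0[OF tendsto_const]
        filterlim_at_top_imp_at_infinity filterlim_tendsto_pos_mult_at_top[OF tendsto_const] filterlim_ident)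
    then have "((\<lambda>x. pi / (2 * fst x) * A n) \<longlongrightarrow> 0) joint_limit"
      by (rule filterlim_compose[OF _ filterlim_fst_joint_limit])
    moreover have "filterlim (\<lambda>x. (case x of (L, K) \<Rightarrow> real K / L) * (pi / 2)) at_top joint_limit"
      using filterlim_ratio_joint_limit
      by (rule filterlim_at_top_mult_tendsto_pos[OF tendsto_const, rotated]) simp
    from filterlim_compose[OF tendsto_set_integral_tail[OF f(3)[OF that]] this]
    have "((\<lambda>x. tail n ((case x of (L, K) \<Rightarrow> real K / L) * (pi / 2))) \<longlongrightarrow> 0) joint_limit"
      by (simp add: tail_def)
    ultimately have "((\<lambda>x. 1 / pi * (pi / (2 * fst x) * A n +
        tail n ((case x of (L, K) \<Rightarrow> real K / L) * (pi / 2)))) \<longlongrightarrow> 1 / pi * (0 + 0)) joint_limit"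
      by (intro tendsto_intros)
    then show ?thesis by (simp add: E_def case_prod_unfold)
  qed
  then have "(\<epsilon> \<longlongrightarrow> (\<Sum>n\<le>2 * r. 0)) joint_limit"
    unfolding \<epsilon>_def by (intro tendsto_sum) simp
  moreover have "\<bar>approx_derivs S L K a b s t - kernel_derivs S a b s t\<bar> \<le> \<epsilon> (L, K)"
    if L: "L > 0" and ab: "a \<le> r" "b \<le> r" and st: "\<bar>s\<bar> \<le> \<Lambda>" "\<bar>t\<bar> \<le> \<Lambda>" for L K a b s t
  proof -
    let ?h = "pi / (2 * L)" and ?n = "a + b"
    let ?\<alpha> = "(real a - real b) * (pi / 2)" and ?\<beta> = "(real a + real b) * (pi / 2)"
    let ?sum = "\<Sum>k = 1..K. ?h * (f ?n (real k * ?h) *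
      (cos (real k * ?h * (s - t) + ?\<alpha>) - (-1) ^ k * cos (real k * ?h * (s + t) + ?\<beta>)))"
    have n: "?n \<le> 2 * r" using ab by simp
    have "\<bar>?sum - (LINT x:{0<..}|lborel. f ?n x * cos (x * (s - t) + ?\<alpha>))\<bar>
        \<le> ?h * A ?n + (LINT x:{real K * ?h<..}|lborel. \<bar>f ?n x\<bar>)"
      unfolding A_def
    proof (rule cosine_quadrature_error[OF f(2)[OF n] f(3)[OF n] f(4)[OF n]])
      show "\<bar>f ?n x\<bar> \<le> \<bar>B ?n\<bar>" if "x > 0" for x
        using B[OF n that] by linarith
    qed (use L st in auto)
    moreover have "real K * ?h = real K / L * (pi / 2)" by simp
    ultimately have "\<bar>?sum - cosine_transform (f ?n) ?\<alpha> (s - t)\<bar>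
        \<le> ?h * A ?n + tail ?n (real K / L * (pi / 2))"
      by (simp only: cosine_transform_def tail_def)
    moreover have "approx_derivs S L K a b s t - kernel_derivs S a b s t
        = 1 / pi * (?sum - cosine_transform (f ?n) ?\<alpha> (s - t))"
      unfolding approx_derivs_eq[OF L] kernel_derivs_def f_def right_diff_distrib[of "1 / pi"] ..
    ultimately have "\<bar>approx_derivs S L K a b s t - kernel_derivs S a b s t\<bar> \<le> E ?n (L, K)"
      by (simp add: E_def abs_mult divide_right_mono)
    also have "\<dots> \<le> \<epsilon> (L, K)"
      unfolding \<epsilon>_def using n E_nonneg[OF L] by (intro member_le_sum) auto
    finally show ?thesis .
  qed
  ultimately show ?thesis by (intro exI[of _ \<epsilon>]) simp
qed

theorem mainTheorem5:
  shows "\<exists>M :: nat \<Rightarrow> real \<Rightarrow> real.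
    \<forall>(r::nat) (t0::real) (t1::real) (\<Lambda>::real) (C :: real \<Rightarrow> real) (S :: real \<Rightarrow> real).
      t0 < t1 \<longrightarrow> \<Lambda> > 0 \<longrightarrow> {t0..t1} \<subseteq> {-\<Lambda>..\<Lambda>} \<longrightarrow>
      covariance_function (stationary_kernel C) \<longrightarrow>
      has_spectral_density C S \<longrightarrow>
      spectral_regularity r S \<longrightarrow>
      (\<forall>L K. L > \<Lambda> \<longrightarrow>
         (MAX (p, q) \<in> {- int r..int r} \<times> {- int r..int r}.
            sup_dist t0 t1 (signed_op2 t0 t1 p q (approx_kernel S L K))
                           (signed_op2 t0 t1 p q (stationary_kernel C)))
         \<le> ennreal (M r (t1 - t0)) *
           (MAX (a, b) \<in> {0..r} \<times> {0..r}.
              sup_dist t0 t1 (mixed_deriv t0 t1 a b (approx_kernel S L K))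
                             (mixed_deriv t0 t1 a b (stationary_kernel C)))) \<and>
      ((\<lambda>(L, K).
          MAX (p, q) \<in> {- int r..int r} \<times> {- int r..int r}.
            sup_dist t0 t1 (signed_op2 t0 t1 p q (approx_kernel S L K))
                           (signed_op2 t0 t1 p q (stationary_kernel C)))
        \<longlongrightarrow> 0) joint_limit"
\<comment> \<open>The witness is the factor from \<open>signed_op2_diff_bound\<close>, with T = t1 -
  t0.\<close>
proof (intro exI[of _ "\<lambda>r T. (1 + T) ^ (2 * r)"] allI impI conjI)
  fix r and t0 t1 \<Lambda> :: real and C S
  assume t: "t0 < t1" and \<Lambda>: "\<Lambda> > 0" and sub: "{t0..t1} \<subseteq> {-\<Lambda>..\<Lambda>}"
    and dens: "has_spectral_density C S" and reg: "spectral_regularity r S"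
  let ?max = "\<lambda>L K. MAX (p, q) \<in> {- int r..int r} \<times> {- int r..int r}.
    sup_dist t0 t1 (signed_op2 t0 t1 p q (approx_kernel S L K))
                   (signed_op2 t0 t1 p q (stationary_kernel C))"
  have kernel: "deriv_family t0 t1 r (kernel_derivs S)"
    by (intro deriv_family_kernel_derivs spectral_regularity_weighted(3)[OF reg])
  note approx = deriv_family_approx_derivs[of t0 t1 r S]
  show "?max L K \<le> ennreal ((1 + (t1 - t0)) ^ (2 * r)) *
      (MAX (a, b) \<in> {0..r} \<times> {0..r}.
        sup_dist t0 t1 (mixed_deriv t0 t1 a b (approx_kernel S L K))
                       (mixed_deriv t0 t1 a b (stationary_kernel C)))" for L K
    unfolding approx_kernel_eq stationary_kernel_eq[OF dens]
    by (rule signed_op2_Max_le[OF t approx kernel])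
  obtain \<epsilon> where \<epsilon>: "(\<epsilon> \<longlongrightarrow> 0) joint_limit"
    and bd: "\<And>L K a b s t. \<lbrakk>L > 0; a \<le> r; b \<le> r; \<bar>s\<bar> \<le> \<Lambda>; \<bar>t\<bar> \<le> \<Lambda>\<rbrakk> \<Longrightarrow>
      \<bar>approx_derivs S L K a b s t - kernel_derivs S a b s t\<bar> \<le> \<epsilon> (L, K)"
    using derivs_error_uniform[OF reg, of \<Lambda>] by blast
  have in_range: "\<bar>x\<bar> \<le> \<Lambda>" if "x \<in> {t0..t1}" for x
    using subsetD[OF sub that] by auto
  \<comment> \<open>The uniform error enters the pointwise estimate for the explicit families
    directly, so the limit is taken of a real bound and not of a maximum of suprema.\<close>
  have bound: "?max L K \<le> ennreal ((1 + (t1 - t0)) ^ (2 * r) * \<epsilon> (L, K))" if "L > 0" for L K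
  proof -
    have "\<bar>approx_derivs S L K a b s t - kernel_derivs S a b s t\<bar> \<le> \<epsilon> (L, K)"
      if "a \<le> r" "b \<le> r" "s \<in> {t0..t1}" "t \<in> {t0..t1}" for a b s t
      using \<open>L > 0\<close> that by (intro bd in_range)
    note signed_op2_diff_bound[OF t approx kernel this]
    then show ?thesis
      unfolding approx_kernel_eq stationary_kernel_eq[OF dens]
      by (intro Max_sup_dist_le) auto
  qed
  have "eventually (\<lambda>x. fst x > 0) joint_limit"
    using filterlim_fst_joint_limit eventually_gt_at_top[of 0]
    by (rule eventually_compose_filterlim[rotated])
  then have upper: "eventually (\<lambda>x. (case x of (L, K) \<Rightarrow> ?max L K)
      \<le> ennreal ((1 + (t1 - t0)) ^ (2 * r) * \<epsilon> x)) joint_limit"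
  proof (rule eventually_mono)
    fix x :: "real \<times> nat" assume "fst x > 0"
    then show "(case x of (L, K) \<Rightarrow> ?max L K) \<le> ennreal ((1 + (t1 - t0)) ^ (2 * r) * \<epsilon> x)"
      using bound by (cases x) (simp only: prod.case fst_conv)
  qed
  have "((\<lambda>x. ennreal ((1 + (t1 - t0)) ^ (2 * r) * \<epsilon> x)) \<longlongrightarrow> 0) joint_limit"
    using tendsto_ennrealI[OF tendsto_mult_right_zero[OF \<epsilon>]] by simp
  then show "((\<lambda>(L, K). ?max L K) \<longlongrightarrow> 0) joint_limit"
    by (rule tendsto_sandwich[OF always_eventually upper tendsto_const, rotated]) simp
qed

end
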